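(* Let $Y$ be a normed space, let $X$ be a reflexive Banach space, and let $\mathcal{M}:Y\rightrightarrows X$ be a multifunction whose graph $\operatorname{gph}\mathcal{M}$ is a nonempty convex set. Let $\overline{y}\in\operatorname{dom}\mathcal{M}$ be such that $\mathcal{M}(\overline{y})$ is closed. Then $$\sup_{x\in\mathcal{M}(\overline{y})}\operatorname{clm}\mathcal{M}(\overline{y},x)=\operatorname{uclm}\mathcal{M}(\overline{y})=\operatorname{Lipusc}\mathcal{M}(\overline{y})=\operatorname{Hof}\mathcal{M}(\overline{y}).$$
   Context: For a multifunction $\mathcal{M}:Y\rightrightarrows X$ between metric spaces (both distances denoted by $d$; for normed spaces, $d$ is induced by the norm): $\operatorname{gph}\mathcal{M}=\{(y,x)\mid x\in\mathcal{M}(y)\}$, $\operatorname{dom}\mathcal{M}=\{y\mid\mathcal{M}(y)\neq\emptyset\}$, and $\mathcal{M}^{-1}(x)=\{y\mid x\in\mathcal{M}(y)\}$. For a point $z$ and a set $\Omega$, $d(z,\Omega)=\inf_{\omega\in\Omega}d(z,\omega)$, with $\inf\emptyset=+\infty$ (so $d(z,\emptyset)=+\infty$). Also $\sup\emptyset=0$. For $S\subset X$ and $\varepsilon>0$, $B(S,\varepsilon)=\{x\in X\mid d(x,S)\leq\varepsilon\}$. For $\overline{y}\in\operatorname{dom}\mathcal{M}$ the following moduli, with values in $[0,+\infty]$, are defined as infima of constants (equal to $+\infty$ if no such constant exists): - Hoffman modulus $\operatorname{Hof}\mathcal{M}(\overline{y})$: the infimum of all $\kappa\geq0$ such that $d(x,\mathcal{M}(\overline{y}))\leq\kappa\,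 d(\overline{y},\mathcal{M}^{-1}(x))$ for all $x\in X$. - Lipschitz upper semicontinuity modulus $\operatorname{Lipusc}\mathcal{M}(\overline{y})$: the infimum of all $\kappa\geq0$ for which there is a neighborhood $V$ of $\overline{y}$ with $d(x,\mathcal{M}(\overline{y}))\leq\kappa\, d(y,\overline{y})$ for all $(y,x)\in(V\times X)\cap\operatorname{gph}\mathcal{M}$. - Modulus of uniform calmness $\operatorname{uclm}\mathcal{M}(\overline{y})$: the infimum of all $\kappa\geq0$ for which there are a neighborhood $V$ of $\overline{y}$ and $\varepsilon>0$ with $d(x,\mathcal{M}(\overline{y}))\leq\kappa\, d(y,\overline{y})$ for all $y\in V$ and all $x\in\mathcal{M}(y)\cap B(\mathcal{M}(\overline{y}),\varepsilon)$. - Calmness modulus $\operatorname{clm}\mathcal{M}(\overline{y},\overline{x})$, for $(\overline{y},\overline{x})\in\operatorname{gph}\mathcal{M}$: the infimum of all $\kappa\geq0$ for which there is a neighborhood $U$ of $\overline{x}$ with $d(x,\mathcal{M}(\overline{y}))\leq\kappa\, d(\overline{y},\mathcal{M}^{-1}(x))$ for all $x\in U$. *)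

theory Defs
  imports "HOL-Analysis.Analysis"
begin

text \<open>A multifunction from \<open>'b\<close> to \<open>'a\<close> is a function \<open>'b \<Rightarrow> 'a set\<close>.\<close>

definition gph :: "('b \<Rightarrow> 'a set) \<Rightarrow> ('b \<times> 'a) set" where
  "gph M = {(y, x). x \<in> M y}"

definition mdom :: "('b \<Rightarrow> 'a set) \<Rightarrow> 'b set" where
  "mdom M = {y. M y \<noteq> {}}"

definition minv :: "('b \<Rightarrow> 'a set) \<Rightarrow> 'a \<Rightarrow> 'b set" where
  "minv M x = {y. x \<in> M y}"

text \<open>Unlike \<^const>\<open>infdist\<close>, which is 0 for the empty set, this distance is \<open>\<infinity>\<close> there.\<close>

definition edist_set :: "'a::metric_space \<Rightarrow> 'a set \<Rightarrow> ennreal" where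
  "edist_set z S = (INF w\<in>S. ennreal (dist z w))"

definition enlargement :: "'a::metric_space set \<Rightarrow> real \<Rightarrow> 'a set" where
  "enlargement S e = {x. edist_set x S \<le> ennreal e}"

text \<open>
  In \<^typ>\<open>ennreal\<close> the infimum of the empty set is \<open>\<infinity>\<close> and the supremum of the empty set
  is 0. A neighbourhood of a point is a set having that point in its interior. Since \<open>0 * \<infinity> = 0\<close>
  in \<^typ>\<open>ennreal\<close>, the constant 0 may fail to be admissible in \<open>Hof\<close> and \<open>clm\<close> when
  \<open>minv M x\<close> is empty; this does not affect the infimum over all constants.
\<close>

definition Hof :: "('b::metric_space \<Rightarrow> 'a::metric_space set) \<Rightarrow> 'b \<Rightarrow> ennreal" where
  "Hof M yb = Inf {ennreal \<kappa> | \<kappa>. 0 \<le> \<kappa> \<and>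
     (\<forall>x. edist_set x (M yb) \<le> ennreal \<kappa> * edist_set yb (minv M x))}"

definition Lipusc :: "('b::metric_space \<Rightarrow> 'a::metric_space set) \<Rightarrow> 'b \<Rightarrow> ennreal" where
  "Lipusc M yb = Inf {ennreal \<kappa> | \<kappa>. 0 \<le> \<kappa> \<and>
     (\<exists>V. yb \<in> interior V \<and>
       (\<forall>(y, x) \<in> (V \<times> UNIV) \<inter> gph M. edist_set x (M yb) \<le> ennreal \<kappa> * ennreal (dist y yb)))}"

definition uclm :: "('b::metric_space \<Rightarrow> 'a::metric_space set) \<Rightarrow> 'b \<Rightarrow> ennreal" where
  "uclm M yb = Inf {ennreal \<kappa> | \<kappa>. 0 \<le> \<kappa> \<and>
     (\<exists>V \<epsilon>. yb \<in> interior V \<and> 0 < \<epsilon> \<and>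
       (\<forall>y\<in>V. \<forall>x \<in> M y \<inter> enlargement (M yb) \<epsilon>.
          edist_set x (M yb) \<le> ennreal \<kappa> * ennreal (dist y yb)))}"

definition clm :: "('b::metric_space \<Rightarrow> 'a::metric_space set) \<Rightarrow> 'b \<Rightarrow> 'a \<Rightarrow> ennreal" where
  "clm M yb xb = Inf {ennreal \<kappa> | \<kappa>. 0 \<le> \<kappa> \<and>
     (\<exists>U. xb \<in> interior U \<and>
       (\<forall>x\<in>U. edist_set x (M yb) \<le> ennreal \<kappa> * edist_set yb (minv M x)))}"

text \<open>Reflexivity: the evaluation map from the space to its bidual is surjective.\<close>

definition reflexive_space :: "'a::real_normed_vector itself \<Rightarrow> bool" where
  "reflexive_space _ \<longleftrightarrow>
     (\<forall>\<Phi> :: ('a \<Rightarrow>\<^sub>L real) \<Rightarrow>\<^sub>L real. \<exists>x :: 'a. \<forall>f.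
        blinfun_apply \<Phi> f = blinfun_apply f x)"

end

theory Submission
  imports Defs
begin

text \<open>
  The only substantial inequality is that \<open>Hof\<close> is at most the supremum of the calmness moduli.
  Had \<open>x\<close> a nearest point \<open>p\<close> in \<open>M yb\<close>, one would apply calmness at \<open>p\<close> to the points
  \<open>p + t (x - p)\<close>, which by convexity of the graph belong to \<open>M (yb + t (y - yb))\<close> when
  \<open>x \<in> M y\<close>, and whose distance to \<open>M yb\<close> is exactly \<open>t\<close> times that of \<open>x\<close>; letting \<open>t\<close>
  be small and dividing by \<open>t\<close> gives the global estimate. Instead of obtaining nearest points from
  weak compactness, the proof takes for \<open>p\<close> an almost minimizer in the sense of Ekeland's
  variational principle, which costs only a factor \<open>(1 - e) / (1 + e)\<close>.
\<close>

section \<open>Ekeland's variational principle on a complete set\<close>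

text \<open>The relation \<open>w \<in> S z\<close> is a preorder along which \<open>f\<close> drops
  at least at rate \<open>e\<close>. A descending sequence of near minimizers is Cauchy, and its
  limit \<open>p\<close> satisfies \<open>S p = {p}\<close>, which is the conclusion.\<close>

lemma ekeland_variational_principle:
  fixes f :: "'a::metric_space \<Rightarrow> real"
  assumes "complete C" "C \<noteq> {}" "continuous_on C f" "bdd_below (f ` C)" "0 < e"
  obtains p where "p \<in> C" "\<And>w. w \<in> C \<Longrightarrow> w \<noteq> p \<Longrightarrow> f p < f w + e * dist p w"
proof -
  define S where "S z = {w \<in> C. f w + e * dist z w \<le> f z}" for z
  have S_self: "z \<in> S z" if "z \<in> C" for z
    using that by (simp add: S_def)
  have S_sub: "S w \<subseteq> S z" if "w \<in> S z" for w z
  proof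
    fix v assume "v \<in> S w"
    moreover have "e * dist z v \<le> e * dist z w + e * dist w v"
      using mult_left_mono[OF dist_triangle[of z v w], of e] \<open>0 < e\<close> by (simp add: algebra_simps)
    ultimately show "v \<in> S z" using that by (auto simp: S_def)
  qed
  have next_ex: "\<exists>w. w \<in> C \<and> w \<in> S z \<and> (\<forall>v\<in>S z. f w \<le> f v + (1/2)^n)" if "z \<in> C" for z n
  proof -
    have ne: "f ` S z \<noteq> {}" and bb: "bdd_below (f ` S z)"
      using S_self[OF that] assms(4) by (auto simp: S_def intro: bdd_below_mono)
    have "Inf (f ` S z) < Inf (f ` S z) + (1/2)^n" by simp
    then obtain w where "w \<in> S z" "f w < Inf (f ` S z) + (1/2)^n"
      using cInf_lessD[OF ne] by blast
    moreover have "Inf (f ` S z) \<le> f v" if "v \<in> S z" for v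
      using bb that by (simp add: cInf_lower)
    ultimately show ?thesis by (fastforce simp: S_def)
  qed
  obtain u where uC: "\<And>n. u n \<in> C"
    and uS: "\<And>n. u (Suc n) \<in> S (u n) \<and> (\<forall>v\<in>S (u n). f (u (Suc n)) \<le> f v + (1/2)^n)"
    using dependent_nat_choice[of "\<lambda>_ z. z \<in> C"
        "\<lambda>n z w. w \<in> S z \<and> (\<forall>v\<in>S z. f w \<le> f v + (1/2)^n)"] next_ex assms(2)
    by (metis ex_in_conv)
  have u_mono: "u m \<in> S (u n)" if "n \<le> m" for n m
    using that
  proof (induction rule: dec_induct)
    case base
    show ?case by (rule S_self[OF uC])
  next
    case (step k)
    then show ?case using S_sub uS by blast
  qed
  \<comment> \<open>Near-minimality of \<open>u (Suc n)\<close> on \<open>S (u n)\<close> limits any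
    further drop of \<open>f\<close> to \<open>(1/2)^n\<close>, and points of
    \<open>S (u (Suc n))\<close> pay for distance with drop at rate \<open>e\<close>.\<close>
  have small: "dist (u (Suc n)) v \<le> (1/2)^n / e" if "v \<in> S (u (Suc n))" for n v
  proof -
    have "v \<in> S (u n)" using that S_sub uS by blast
    then have "f (u (Suc n)) \<le> f v + (1/2)^n" using uS by blast
    with that have "e * dist (u (Suc n)) v \<le> (1/2)^n" by (simp add: S_def)
    then show ?thesis using \<open>0 < e\<close> by (simp add: pos_le_divide_eq mult.commute)
  qed
  have lim0: "(\<lambda>n. (1/2)^n / e) \<longlonglongrightarrow> 0"
    using tendsto_divide[OF LIMSEQ_power_zero[of "1/2::real"] tendsto_const[of e]] \<open>0 < e\<close> by simp
  have "Cauchy u"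
  proof (rule metric_CauchyI)
    fix r :: real assume "0 < r"
    then have "\<forall>\<^sub>F n in sequentially. (1/2)^n / e < r/2"
      by (intro order_tendstoD(2)[OF lim0]) simp
    then obtain N where N: "(1/2)^N / e < r/2" by (auto simp: eventually_sequentially)
    have "dist (u (Suc N)) (u m) < r/2" if "m \<ge> Suc N" for m
      using small[OF u_mono[OF that]] N by (rule le_less_trans)
    then have "\<forall>m\<ge>Suc N. \<forall>n\<ge>Suc N. dist (u m) (u n) < r"
      using dist_triangle_half_r by blast
    then show "\<exists>M. \<forall>m\<ge>M. \<forall>n\<ge>M. dist (u m) (u n) < r" ..
  qed
  then obtain p where pC: "p \<in> C" and up: "u \<longlonglongrightarrow> p"
    using assms(1) uC unfolding complete_def by blast
  have fup: "(\<lambda>n. f (u n)) \<longlonglongrightarrow> f p"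
    using assms(3) pC uC up by (simp add: continuous_on_sequentially o_def)
  \<comment> \<open>The inequality defining \<open>S (u n)\<close> survives the limit because
    \<open>f\<close> is continuous.\<close>
  have pS: "p \<in> S (u n)" for n
  proof -
    have "(\<lambda>m. f (u m) + e * dist (u n) (u m)) \<longlonglongrightarrow> f p + e * dist (u n) p"
      by (intro tendsto_intros fup up)
    moreover have "\<forall>m\<ge>n. f (u m) + e * dist (u n) (u m) \<le> f (u n)"
      using u_mono by (auto simp: S_def)
    ultimately have "f p + e * dist (u n) p \<le> f (u n)" by (blast intro: LIMSEQ_le_const2)
    then show ?thesis using pC by (simp add: S_def)
  qed
  \<comment> \<open>Such a \<open>v\<close> lies in every \<open>S (u (Suc n))\<close>, so
    \<open>small\<close> makes it a second limit of \<open>u\<close>.\<close>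
  have "v = p" if "v \<in> S p" for v
  proof -
    have "dist (u (Suc n)) v \<le> (1/2)^n / e" for n
      using S_sub[OF pS] that small by blast
    then have "(\<lambda>n. dist (u (Suc n)) v) \<longlonglongrightarrow> 0"
      by (intro tendsto_sandwich[OF _ _ tendsto_const lim0]) auto
    then have "(\<lambda>n. u (Suc n)) \<longlonglongrightarrow> v" by (rule tendsto_dist_iff[THEN iffD2])
    with up show ?thesis using LIMSEQ_Suc LIMSEQ_unique by blast
  qed
  then have "f p < f w + e * dist p w" if "w \<in> C" "w \<noteq> p" for w
    using that by (auto simp: S_def not_le[symmetric])
  with pC show thesis by (rule that)
qed

section \<open>Extended-valued distance to a set\<close>

lemma edist_set_le: "w \<in> S \<Longrightarrow> edist_set z S \<le> ennreal (dist z w)"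
  unfolding edist_set_def by (rule INF_lower)

text \<open>Allows the estimates below to be carried out in real arithmetic once the empty set is
  split off.\<close>

lemma edist_set_eq_infdist:
  assumes "S \<noteq> {}"
  shows "edist_set z S = ennreal (infdist z S)"
proof (rule antisym)
  show "ennreal (infdist z S) \<le> edist_set z S"
    unfolding edist_set_def by (intro INF_greatest ennreal_leI infdist_le)
  show "edist_set z S \<le> ennreal (infdist z S)"
  proof (rule ennreal_le_epsilon)
    fix d :: real assume "0 < d"
    then have "Inf (dist z ` S) < infdist z S + d" using assms by (simp add: infdist_notempty)
    then obtain w where "w \<in> S" "dist z w < infdist z S + d"
      using cInf_lessD[of "dist z ` S"] assms by blast
    then show "edist_set z S \<le> ennreal (infdist z S) + ennreal d"
      using \<open>0 < d\<close>
      by (auto simp: infdist_nonneg simp flip: ennreal_plus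
          intro!: order_trans[OF edist_set_le] ennreal_leI)
  qed
qed

section \<open>The inequalities that need no convexity\<close>

text \<open>A constant admissible for \<open>Hof\<close> is admissible for \<open>Lipusc\<close>
  with \<open>V = UNIV\<close>: if \<open>x \<in> M y\<close>, then \<open>y\<close> competes in the
  infimum defining the distance from \<open>yb\<close> to \<open>minv M x\<close>.\<close>

lemma Lipusc_le_Hof: "Lipusc M yb \<le> Hof M yb"
  unfolding Lipusc_def Hof_def
proof (rule Inf_superset_mono, safe)
  fix k :: real
  assume k: "0 \<le> k" "\<forall>x. edist_set x (M yb) \<le> ennreal k * edist_set yb (minv M x)"
  have "edist_set x (M yb) \<le> ennreal k * ennreal (dist y yb)" if "x \<in> M y" for x y
  proof -
    have "edist_set yb (minv M x) \<le> ennreal (dist y yb)"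
      using edist_set_le[of y "minv M x" yb] that by (simp add: minv_def dist_commute)
    then show ?thesis using k(2) by (meson mult_left_mono order_trans zero_le)
  qed
  then show "\<exists>\<kappa>. ennreal k = ennreal \<kappa> \<and> 0 \<le> \<kappa> \<and> (\<exists>V. yb \<in> interior V \<and>
      (\<forall>(y, x)\<in>V \<times> UNIV \<inter> gph M. edist_set x (M yb) \<le> ennreal \<kappa> * ennreal (dist y yb)))"
    using k(1) by (intro exI[of _ k] conjI exI[of _ UNIV]) (auto simp: gph_def)
qed

lemma uclm_le_Lipusc: "uclm M yb \<le> Lipusc M yb"
  unfolding uclm_def Lipusc_def
proof (rule Inf_superset_mono, safe)
  fix k :: real and V
  assume "0 \<le> k" "yb \<in> interior V"
    "\<forall>(y, x)\<in>V \<times> UNIV \<inter> gph M. edist_set x (M yb) \<le> ennreal k * ennreal (dist y yb)"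
  then show "\<exists>\<kappa>. ennreal k = ennreal \<kappa> \<and> 0 \<le> \<kappa> \<and> (\<exists>V \<epsilon>. yb \<in> interior V \<and> 0 < \<epsilon> \<and>
      (\<forall>y\<in>V. \<forall>x\<in>M y \<inter> enlargement (M yb) \<epsilon>.
        edist_set x (M yb) \<le> ennreal \<kappa> * ennreal (dist y yb)))"
    by (intro exI[of _ k] conjI exI[of _ V] exI[of _ 1]) (auto simp: gph_def)
qed

text \<open>The condition in \<open>clm\<close> involves all \<open>y\<close> with
  \<open>x \<in> M y\<close>, also those far from \<open>yb\<close>. Near \<open>yb\<close> the
  uniform estimate applies; far from \<open>yb\<close> the right-hand side is bounded below, while
  the left-hand side is small for \<open>x\<close> close to \<open>xb\<close>.\<close>

lemma clm_le_uclm: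
  assumes "xb \<in> M yb"
  shows "clm M yb xb \<le> uclm M yb"
  unfolding uclm_def
proof (rule Inf_greatest, safe)
  fix k e :: real and V
  assume k: "0 \<le> k" and V: "yb \<in> interior V" and e: "0 < e"
    and adm: "\<forall>y\<in>V. \<forall>x\<in>M y \<inter> enlargement (M yb) e.
      edist_set x (M yb) \<le> ennreal k * ennreal (dist y yb)"
  have ne: "M yb \<noteq> {}" using assms by auto
  obtain r where r: "0 < r" "ball yb r \<subseteq> V" using V by (auto simp: mem_interior)
  show "clm M yb xb \<le> ennreal k"
  \<comment> \<open>Points \<open>y\<close> outside \<open>V\<close> are harmless only for a positive constant, hence the \<open>d\<close>.\<close>
  proof (rule ennreal_le_epsilon)
    fix d :: real assume d: "0 < d"
    \<comment> \<open>Radius \<open>e\<close> puts \<open>x\<close> into the enlargement; radius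
      \<open>d * r\<close> makes its distance to \<open>M yb\<close> less than
      \<open>d * dist yb y\<close> whenever \<open>y\<close> is outside
      \<open>ball yb r\<close>.\<close>
    define U where "U = ball xb (min e (d * r))"
    have "edist_set x (M yb) \<le> ennreal (k + d) * edist_set yb (minv M x)" if x: "x \<in> U" for x
    proof (cases "minv M x = {}")
      case True
      \<comment> \<open>The right-hand side is a positive constant times infinity.\<close>
      then show ?thesis using k d by (simp add: edist_set_def ennreal_mult_top)
    next
      case False
      have near: "infdist x (M yb) < min e (d * r)"
        using infdist_le[OF assms, of x] x by (simp add: U_def dist_commute)
      have "infdist x (M yb) / (k + d) \<le> dist yb y" if y: "y \<in> minv M x" for y
      proof -
        have "infdist x (M yb) \<le> (k + d) * dist yb y"
        proof (cases "y \<in> ball yb r")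
          case True
          have "x \<in> enlargement (M yb) e"
            using near ne by (simp add: enlargement_def edist_set_eq_infdist ennreal_leI)
          then have "edist_set x (M yb) \<le> ennreal k * ennreal (dist y yb)"
            using adm True r y by (auto simp: minv_def)
          moreover have "edist_set x (M yb) = ennreal (infdist x (M yb))"
            using ne by (rule edist_set_eq_infdist)
          ultimately have "infdist x (M yb) \<le> k * dist y yb"
            using k by (simp add: ennreal_mult[symmetric])
          also have "\<dots> \<le> (k + d) * dist yb y"
            using d by (simp add: dist_commute mult_right_mono)
          finally show ?thesis .
        next
          case False
          then have "d * r \<le> d * dist yb y" using d by simp
          then show ?thesis using near k by (simp add: distrib_right add_increasing)
        qed
        then show ?thesis using k d by (simp add: pos_divide_le_eq mult.commute)
      qed
      then have "infdist x (M yb) / (k + d) \<le> infdist yb (minv M x)"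
        using False by (simp add: infdist_notempty cINF_greatest)
      then have "infdist x (M yb) \<le> (k + d) * infdist yb (minv M x)"
        using k d by (simp add: pos_divide_le_eq mult.commute)
      then have "ennreal (infdist x (M yb)) \<le> ennreal (k + d) * ennreal (infdist yb (minv M x))"
        using k d by (simp only: ennreal_leI add_nonneg_nonneg less_imp_le flip: ennreal_mult')
      then show ?thesis
        by (simp only: edist_set_eq_infdist[OF ne] edist_set_eq_infdist[OF False])
    qed
    moreover have "xb \<in> interior U"
      using e d r by (simp add: U_def interior_open)
    ultimately have "clm M yb xb \<le> ennreal (k + d)"
      unfolding clm_def using k d
      by (intro Inf_lower CollectI exI[of _ "k + d"] conjI exI[of _ U] ballI) auto
    then show "clm M yb xb \<le> ennreal k + ennreal d"
      using k d by simp
  qed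
qed

section \<open>From local calmness to the global bound\<close>

text \<open>Strictness provides an admissible constant below \<open>k\<close>; each \<open>y\<close>
  with \<open>x \<in> M y\<close> then bounds the distance to \<open>minv M x\<close>, which gives a
  pointwise real inequality.\<close>

lemma clm_lessD:
  assumes "clm M yb p < ennreal k" "M yb \<noteq> {}"
  obtains r where "0 < r" "\<And>x y. dist p x < r \<Longrightarrow> x \<in> M y \<Longrightarrow> infdist x (M yb) \<le> k * dist yb y"
proof -
  obtain j U where j: "0 \<le> j" "ennreal j < ennreal k" and U: "p \<in> interior U"
    and adm: "\<forall>x\<in>U. edist_set x (M yb) \<le> ennreal j * edist_set yb (minv M x)"
    using assms(1) unfolding clm_def by (auto simp: Inf_less_iff)
  obtain r where r: "0 < r" "ball p r \<subseteq> U" using U by (auto simp: mem_interior)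
  have "infdist x (M yb) \<le> k * dist yb y" if "dist p x < r" "x \<in> M y" for x y
  proof -
    have "edist_set x (M yb) \<le> ennreal j * edist_set yb (minv M x)"
      using adm r that by auto
    also have "\<dots> \<le> ennreal j * ennreal (dist yb y)"
      using that by (intro mult_left_mono edist_set_le) (auto simp: minv_def)
    finally have "infdist x (M yb) \<le> j * dist yb y"
      using assms(2) j by (simp add: edist_set_eq_infdist ennreal_mult[symmetric])
    also have "\<dots> \<le> k * dist yb y"
      using j by (intro mult_right_mono) (auto simp: ennreal_less_iff)
    finally show ?thesis .
  qed
  with r(1) show thesis by (rule that)
qed

text \<open>For \<open>e = 0\<close> the point \<open>p\<close> is nearest to \<open>x\<close>, and
  moving from \<open>x\<close> towards \<open>p\<close> shrinks the distance to \<open>C\<close> at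
  most by the factor \<open>t\<close>. The slack \<open>e\<close> in \<open>ek\<close> costs the
  factor \<open>(1 - e) / (1 + e)\<close>.\<close>

lemma infdist_segment_ge:
  fixes x p :: "'a::real_normed_vector"
  assumes p: "p \<in> C" and t: "0 \<le> t" "t \<le> 1" and e: "0 \<le> e" "e \<le> 1"
    and ek: "\<And>w. w \<in> C \<Longrightarrow> dist x p \<le> dist x w + e * dist p w"
  shows "t * (1 - e) * infdist x C \<le> (1 + e) * infdist (p + t *\<^sub>R (x - p)) C"
proof -
  let ?q = "p + t *\<^sub>R (x - p)"
  have pq: "dist p ?q = t * dist x p" using t by (simp add: dist_norm)
  have "x - ?q = (1 - t) *\<^sub>R (x - p)" by (simp add: algebra_simps)
  then have xq: "dist x ?q = (1 - t) * dist x p" using t by (simp add: dist_norm)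
  have "t * (1 - e) * infdist x C / (1 + e) \<le> dist ?q w" if w: "w \<in> C" for w
  proof -
    \<comment> \<open>Both \<open>dist x w\<close> and \<open>dist p w\<close> are routed through
      \<open>?q\<close>, which splits \<open>dist x p\<close> in the ratio \<open>1 - t\<close> to
      \<open>t\<close>.\<close>
    have "dist x p \<le> (1 - t) * dist x p + dist ?q w + e * dist p w"
      using ek[OF w] dist_triangle[of x w ?q] by (simp add: xq)
    moreover have "e * dist p w \<le> e * (t * dist x p + dist ?q w)"
      using dist_triangle[of p w ?q] e unfolding pq by (intro mult_left_mono) auto
    ultimately have "t * (1 - e) * dist x p \<le> (1 + e) * dist ?q w"
      by (simp add: algebra_simps)
    moreover have "t * (1 - e) * infdist x C \<le> t * (1 - e) * dist x p"
      using t e infdist_le[OF p] by (intro mult_left_mono) auto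
    ultimately show ?thesis using e by (simp add: pos_divide_le_eq mult.commute)
  qed
  then have "t * (1 - e) * infdist x C / (1 + e) \<le> infdist ?q C"
    using p by (subst infdist_notempty) (auto intro: cINF_greatest)
  then show ?thesis using e by (simp add: pos_divide_le_eq mult.commute)
qed

text \<open>The order of choices matters: the calmness radius \<open>r\<close> depends on
  \<open>p\<close>, and \<open>p\<close> on \<open>e\<close>. So \<open>e\<close> is fixed first
  from the gap between \<open>D\<close> and \<open>E\<close>, and only \<open>t\<close> is adapted
  to \<open>r\<close>; it cancels at the end.\<close>

lemma global_bound_of_clm:
  fixes M :: "'b::real_normed_vector \<Rightarrow> 'a::banach set"
  assumes "convex (gph M)" "M yb \<noteq> {}" "closed (M yb)"
    and clm: "\<And>p. p \<in> M yb \<Longrightarrow> clm M yb p < ennreal k" and x: "x \<in> M y" and k: "0 < k"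
  shows "infdist x (M yb) \<le> k * dist yb y"
proof (rule ccontr)
  define D E where "D = infdist x (M yb)" and "E = k * dist yb y"
  assume "\<not> infdist x (M yb) \<le> k * dist yb y"
  then have DE: "E < D" by (simp add: D_def E_def)
  have E0: "0 \<le> E" using k by (simp add: E_def)
  \<comment> \<open>Small enough that \<open>(1 - e) * D > (1 + e) * E\<close>.\<close>
  define e where "e = (D - E) / (2 * (D + E))"
  have e: "0 < e" "e < 1" using DE E0 by (auto simp: e_def)
  have "e * (D + E) = (D - E) / 2" using DE E0 by (simp add: e_def field_simps)
  then have eDE: "(1 + e) * E < (1 - e) * D" using DE by (simp add: algebra_simps)
  obtain p where p: "p \<in> M yb"
    and ek: "\<And>w. w \<in> M yb \<Longrightarrow> w \<noteq> p \<Longrightarrow> dist x p < dist x w + e * dist p w"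
  proof (rule ekeland_variational_principle)
    show "complete (M yb)" using assms(3) by (simp add: complete_eq_closed)
    show "continuous_on (M yb) (dist x)" by (intro continuous_intros)
    show "bdd_below (dist x ` M yb)" by (rule bdd_belowI[of _ 0]) auto
  qed (use assms(2) e in auto)
  obtain r where r: "0 < r"
    and loc: "\<And>x y. dist p x < r \<Longrightarrow> x \<in> M y \<Longrightarrow> infdist x (M yb) \<le> k * dist yb y"
    using clm_lessD[OF clm[OF p] assms(2)] by blast
  \<comment> \<open>The point at parameter \<open>t\<close> must lie on the segment and within
    \<open>r\<close> of \<open>p\<close>; the summand 1 keeps the denominator positive.\<close>
  define t where "t = min 1 (r / (2 * (1 + dist x p)))"
  have t: "0 < t" "t \<le> 1" using r by (auto simp: t_def add_pos_nonneg)
  have "t \<le> r / (2 * (1 + dist x p))" by (simp add: t_def)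
  moreover have "0 < 2 * (1 + dist x p)" by (simp add: add_pos_nonneg)
  ultimately have "t * (2 * (1 + dist x p)) \<le> r" by (simp only: pos_le_divide_eq)
  moreover have "0 \<le> t * dist x p" using t by simp
  ultimately have tr: "t * dist x p < r" using t unfolding distrib_left by linarith
  \<comment> \<open>Convexity of the graph moves the parameter from \<open>yb\<close> towards
    \<open>y\<close> by the same fraction \<open>t\<close>, so both sides of the estimate scale with
    \<open>t\<close>.\<close>
  have "(1 - t) *\<^sub>R (yb, p) + t *\<^sub>R (y, x) \<in> gph M"
    using assms(1) p x t by (intro convexD) (auto simp: gph_def)
  then have "p + t *\<^sub>R (x - p) \<in> M (yb + t *\<^sub>R (y - yb))"
    by (simp add: gph_def algebra_simps)
  moreover have "dist p (p + t *\<^sub>R (x - p)) < r"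
    using tr t by (simp add: dist_norm)
  ultimately have "infdist (p + t *\<^sub>R (x - p)) (M yb) \<le> k * dist yb (yb + t *\<^sub>R (y - yb))"
    by (intro loc)
  also have "\<dots> = t * E" using t by (simp add: E_def dist_norm norm_minus_commute)
  finally have up: "infdist (p + t *\<^sub>R (x - p)) (M yb) \<le> t * E" .
  have "t * (1 - e) * D \<le> (1 + e) * infdist (p + t *\<^sub>R (x - p)) (M yb)"
    unfolding D_def
  proof (rule infdist_segment_ge[OF p])
    fix w assume "w \<in> M yb"
    then show "dist x p \<le> dist x w + e * dist p w"
      using ek[of w] by (cases "w = p") auto
  qed (use t e in auto)
  also have "\<dots> \<le> (1 + e) * (t * E)" using up e by (intro mult_left_mono) auto
  finally have "t * ((1 - e) * D) \<le> t * ((1 + e) * E)" by (simp add: algebra_simps)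
  then show False using t eDE by simp
qed

text \<open>Any finite \<open>c\<close> strictly above the supremum exceeds the calmness modulus at
  every point of \<open>M yb\<close>, so the global bound makes it admissible for
  \<open>Hof\<close>.\<close>

lemma Hof_le_SUP_clm:
  fixes M :: "'b::real_normed_vector \<Rightarrow> 'a::banach set"
  assumes "convex (gph M)" "M yb \<noteq> {}" "closed (M yb)"
  shows "Hof M yb \<le> (SUP x\<in>M yb. clm M yb x)"
proof (rule dense_ge)
  fix c assume c: "(SUP x\<in>M yb. clm M yb x) < c"
  show "Hof M yb \<le> c"
  proof (cases c)
    case (real k)
    \<comment> \<open>Positivity of the constant covers empty \<open>minv M x\<close>, where the
      bound must be infinite, and permits division by \<open>k\<close>.\<close>
    have "0 < c" using zero_le c by (rule le_less_trans)
    then have k: "0 < k" using real(2) by simp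
    have clm: "clm M yb p < ennreal k" if "p \<in> M yb" for p
      using SUP_upper[OF that] c unfolding real(2) by (rule le_less_trans)
    have "edist_set x (M yb) \<le> ennreal k * edist_set yb (minv M x)" for x
    proof (cases "minv M x = {}")
      case True
      then show ?thesis using k by (simp add: edist_set_def ennreal_mult_top)
    next
      case False
      have "infdist x (M yb) / k \<le> dist yb y" if "y \<in> minv M x" for y
        using global_bound_of_clm[OF assms clm _ k, of x y] that k
        by (simp add: minv_def pos_divide_le_eq mult.commute)
      then have "infdist x (M yb) / k \<le> infdist yb (minv M x)"
        using False by (simp add: infdist_notempty cINF_greatest)
      then have "infdist x (M yb) \<le> k * infdist yb (minv M x)"
        using k by (simp add: pos_divide_le_eq mult.commute)
      then have "ennreal (infdist x (M yb)) \<le> ennreal k * ennreal (infdist yb (minv M x))"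
        using k by (simp only: ennreal_leI less_imp_le flip: ennreal_mult')
      then show ?thesis
        by (simp only: edist_set_eq_infdist[OF assms(2)] edist_set_eq_infdist[OF False])
    qed
    then show ?thesis
      unfolding Hof_def real(2) using k
      by (intro Inf_lower CollectI exI[of _ k] conjI allI) auto
  qed simp
qed

theorem theorem4:
  fixes M :: "'b::real_normed_vector \<Rightarrow> 'a::banach set"
    and yb :: 'b
  assumes "reflexive_space TYPE('a)"
    and "gph M \<noteq> {}"
    and "convex (gph M)"
    and "yb \<in> mdom M"
    and "closed (M yb)"
  shows "(SUP x\<in>M yb. clm M yb x) = uclm M yb
       \<and> uclm M yb = Lipusc M yb
       \<and> Lipusc M yb = Hof M yb"
proof -
  have "M yb \<noteq> {}" using assms(4) by (simp add: mdom_def)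
  then have "Hof M yb \<le> (SUP x\<in>M yb. clm M yb x)"
    using assms by (intro Hof_le_SUP_clm)
  moreover have "(SUP x\<in>M yb. clm M yb x) \<le> uclm M yb"
    by (intro SUP_least clm_le_uclm)
  \<comment> \<open>The four inequalities form a cycle, which forces equality throughout.\<close>
  ultimately show ?thesis
    using uclm_le_Lipusc[of M yb] Lipusc_le_Hof[of M yb] by (meson order.antisym order.trans)
qed

end
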